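(* (Completeness.) Let $r\in\{f,\beta\}$, let $U_1,\dots,U_n,U\in\mathbb U$ and let $M\in\mathcal M$ with $FV(M)=\{x_1,\dots,x_n\}$. If for every $r$-interpretation $\mathcal I$ and all $N_i\in\mathcal I(U_i)$ ($1\le i\le n$) we have $M[(x_i:=N_i)_1^n]\in\mathcal I(U)$, then $M:\langle (x_i:U_i)_n\vdash U\rangle$ is derivable.
   Context: Terms: $\mathcal V$ is a denumerably infinite set of variables; $\mathcal M$ is the set of untyped $\lambda$-terms $M::=x\mid \lambda x.M\mid MM$ taken modulo $\alpha$-conversion; $FV(M)$ is the set of free variables; $M[(x_i:=N_i)_1^n]$ is simultaneous capture-avoiding substitution. $\rhd_\beta$ is the compatible closure of $(\lambda x.M)N\rhd_\beta M[x:=N]$. Weak head reduction: $M\rhd_f N$ iff $M=(\lambda x.P)QQ_1\dots Q_n$ and $N=P[x:=Q]Q_1\dots Q_n$ for some $n\ge 0$. $\rhd_r^*$ is the reflexive-transitive closure of $\rhd_r$. Types: $\mathcal A$ is a denumerably infinite set of atomic types; $\mathbb T::=a\mid \mathbb U\to\mathbb T$ ($a\in\mathcal A$) and $\mathbb U::=\omega\mid \mathbb U\sqcap\mathbb U\mid \mathbb T$; types are quotiented by commutativity, associativity and idempotence of $\sqcap$ and by $\omega\sqcap U=U$. $T$ ranges over $\mathbb T$, $U,V$ over $\mathbb U$. Environments: a type environment is a finite set $(x_i:U_i)_n$ of declarations with pairwise distinct variables; $dom$ is its set of variables; $()$ is the empty environment; $\Gamma,x:U$ requires $x\notin dom(\Gamma)$;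 $env^M_\omega$ assigns $\omega$ to each variable of $FV(M)$ and nothing else; if $\Gamma_1=(x_i:U_i)_n,(y_j:V_j)_m$ and $\Gamma_2=(x_i:U'_i)_n,(z_k:W_k)_l$ with the $y_j$, $z_k$ all distinct, then $\Gamma_1\sqcap\Gamma_2=(x_i:U_i\sqcap U'_i)_n,(y_j:V_j)_m,(z_k:W_k)_l$. Subtyping: $\sqsubseteq$ (on types, on environments, and on typings $\langle\Gamma\vdash U\rangle$) is the least relation closed under: $\Phi\sqsubseteq\Phi$; transitivity; $U_1\sqcap U_2\sqsubseteq U_1$; if $U_1\sqsubseteq V_1$ and $U_2\sqsubseteq V_2$ then $U_1\sqcap U_2\sqsubseteq V_1\sqcap V_2$; if $U_2\sqsubseteq U_1$ and $T_1\sqsubseteq T_2$ then $U_1\to T_1\sqsubseteq U_2\to T_2$; if $U_1\sqsubseteq U_2$ and $x\notin dom(\Gamma)$ then $\Gamma,x:U_1\sqsubseteq\Gamma,x:U_2$; if $U_1\sqsubseteq U_2$ and $\Gamma_2\sqsubseteq\Gamma_1$ then $\langle\Gamma_1\vdash U_1\rangle\sqsubseteq\langle\Gamma_2\vdash U_2\rangle$. Typing rules for $M:\langle\Gamma\vdash U\rangle$: (ax) $x:\langle x:T\vdash T\rangle$ for $T\in\mathbb T$; ($\omega$) $M:\langle env^M_\omega\vdash\omega\rangle$; ($\to_i$) from $M:\langle\Gamma,x:U\vdash T\rangle$ infer $\lambda x.M:\langle\Gamma\vdash U\to T\rangle$; ($\to'_i$) from $M:\langle\Gamma\vdash T\rangle$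 and $x\notin dom(\Gamma)$ infer $\lambda x.M:\langle\Gamma\vdash\omega\to T\rangle$; ($\to_e$) from $M_1:\langle\Gamma_1\vdash U\to T\rangle$ and $M_2:\langle\Gamma_2\vdash U\rangle$ infer $M_1M_2:\langle\Gamma_1\sqcap\Gamma_2\vdash T\rangle$; ($\sqcap_i$) from $M:\langle\Gamma\vdash U_1\rangle$ and $M:\langle\Gamma\vdash U_2\rangle$ infer $M:\langle\Gamma\vdash U_1\sqcap U_2\rangle$; ($\sqsubseteq$) from $M:\langle\Gamma\vdash U\rangle$ and $\langle\Gamma\vdash U\rangle\sqsubseteq\langle\Gamma'\vdash U'\rangle$ infer $M:\langle\Gamma'\vdash U'\rangle$. Semantics: for $\mathcal X,\mathcal Y\subseteq\mathcal M$, $\mathcal X\leadsto\mathcal Y=\{M\in\mathcal M\mid MN\in\mathcal Y\text{ for all }N\in\mathcal X\}$. For $r\in\{f,\beta\}$, $\mathcal X$ is $r$-saturated if $M\rhd_r^*N$ and $N\in\mathcal X$ imply $M\in\mathcal X$. An $r$-interpretation is a function $\mathcal I:\mathcal A\to\mathcal P(\mathcal M)$ with every $\mathcal I(a)$ $r$-saturated, extended to $\mathbb U$ by $\mathcal I(\omega)=\mathcal M$, $\mathcal I(U_1\sqcap U_2)=\mathcal I(U_1)\cap\mathcal I(U_2)$, $\mathcal I(U\to T)=\mathcal I(U)\leadsto\mathcal I(T)$. *)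

theory Defs
  imports Main "HOL-Library.FSet" "HOL-Library.Finite_Map"
begin

section \<open>Lambda-terms modulo alpha-conversion\<close>

type_synonym var = nat

text \<open>
  Terms modulo alpha-conversion are represented by nameless terms: below \<open>d\<close> binders, the
  index \<open>i < d\<close> is a bound variable and \<open>d + x\<close> is the free variable \<open>x\<close>. So a free variable
  of a term is just a natural number, and every nameless term is a lambda-term. \<open>Abs\<close> is the
  nameless binder; the abstraction \<open>Lam x M\<close> over a named variable is derived from it. All
  later definitions use \<open>Lam\<close>, never \<open>Abs\<close>, and the lemmas \<open>Lam_eq_iff\<close>,
  \<open>Abs_is_Lam\<close>, \<open>FV_Lam\<close> and \<open>subst_Lam\<close> show that \<open>Lam\<close> is abstraction modulo alpha.
\<close>

datatype trm = Var var | App trm trm | Abs trm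

primrec FV :: "trm \<Rightarrow> var set" where
  "FV (Var x) = {x}"
| "FV (App M N) = FV M \<union> FV N"
| "FV (Abs t) = {x. Suc x \<in> FV t}"

primrec rename :: "(var \<Rightarrow> var) \<Rightarrow> trm \<Rightarrow> trm" where
  "rename f (Var x) = Var (f x)"
| "rename f (App M N) = App (rename f M) (rename f N)"
| "rename f (Abs t) = Abs (rename (case_nat 0 (\<lambda>x. Suc (f x))) t)"

primrec subst :: "(var \<Rightarrow> trm) \<Rightarrow> trm \<Rightarrow> trm" where
  "subst \<sigma> (Var x) = \<sigma> x"
| "subst \<sigma> (App M N) = App (subst \<sigma> M) (subst \<sigma> N)"
| "subst \<sigma> (Abs t) = Abs (subst (case_nat (Var 0) (\<lambda>x. rename Suc (\<sigma> x))) t)"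

definition Lam :: "var \<Rightarrow> trm \<Rightarrow> trm" where
  "Lam x M = Abs (rename (\<lambda>y. if y = x then 0 else Suc y) M)"

abbreviation subst1 :: "trm \<Rightarrow> var \<Rightarrow> trm \<Rightarrow> trm" ("_\<lbrakk>_:=_\<rbrakk>" [1000, 0, 0] 1000) where
  "M\<lbrakk>x:=N\<rbrakk> \<equiv> subst (Var(x := N)) M"

definition msubst :: "trm \<Rightarrow> var list \<Rightarrow> trm list \<Rightarrow> trm" where
  "msubst M xs Ns =
     subst (\<lambda>y. case map_of (zip xs Ns) y of Some N \<Rightarrow> N | None \<Rightarrow> Var y) M"

lemma finite_FV: "finite (FV M)"
proof (induction M)
  case (Abs t)
  have "FV (Abs t) \<subseteq> (\<lambda>y. y - 1) ` FV t"
    by (force simp: image_iff)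
  with Abs show ?case using finite_subset by blast
qed auto

lemma FV_rename: "FV (rename f M) = f ` FV M"
proof (induction M arbitrary: f)
  case (Abs t)
  show ?case
  proof (intro set_eqI iffI)
    fix x assume "x \<in> FV (rename f (Abs t))"
    then obtain y where "y \<in> FV t" "Suc x = case_nat 0 (\<lambda>x. Suc (f x)) y"
      by (auto simp: Abs)
    then show "x \<in> f ` FV (Abs t)" by (cases y) auto
  next
    fix x assume "x \<in> f ` FV (Abs t)"
    then show "x \<in> FV (rename f (Abs t))" by (force simp: Abs image_iff)
  qed
qed auto

lemma rename_cong: "(\<And>x. x \<in> FV M \<Longrightarrow> f x = g x) \<Longrightarrow> rename f M = rename g M"
proof (induction M arbitrary: f g)
  case (Abs t)
  have "rename (case_nat 0 (\<lambda>x. Suc (f x))) t = rename (case_nat 0 (\<lambda>x. Suc (g x))) t"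
  proof (rule Abs.IH)
    fix x assume "x \<in> FV t"
    with Abs.prems show "(case_nat 0 (\<lambda>x. Suc (f x))) x = (case_nat 0 (\<lambda>x. Suc (g x))) x" by (cases x) auto
  qed
  then show ?case by simp
next
  case (App M N)
  have "rename f M = rename g M" "rename f N = rename g N"
    by (rule App.IH, simp add: App.prems)+
  then show ?case by simp
qed simp_all

lemma rename_rename: "rename f (rename g M) = rename (\<lambda>x. f (g x)) M"
proof (induction M arbitrary: f g)
  case (Abs t)
  have "(\<lambda>x. case_nat 0 (\<lambda>x. Suc (f x)) (case_nat 0 (\<lambda>x. Suc (g x)) x))
      = case_nat 0 (\<lambda>x. Suc (f (g x)))"
    by (rule ext) (simp split: nat.split)
  then show ?case by (simp add: Abs)
qed auto

lemma rename_id: "(\<And>x. x \<in> FV M \<Longrightarrow> f x = x) \<Longrightarrow> rename f M = M"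
proof (induction M arbitrary: f)
  case (Abs t)
  from Abs.prems show ?case by (auto intro!: Abs.IH split: nat.split)
qed auto

lemma rename_conv_subst: "rename f M = subst (\<lambda>x. Var (f x)) M"
proof (induction M arbitrary: f)
  case (Abs t)
  have "(\<lambda>x. Var (case_nat 0 (\<lambda>x. Suc (f x)) x)) = case_nat (Var 0) (\<lambda>x. rename Suc (Var (f x)))"
    by (rule ext) (simp split: nat.split)
  then show ?case by (simp add: Abs)
qed auto

lemma subst_cong: "(\<And>x. x \<in> FV M \<Longrightarrow> \<sigma> x = \<tau> x) \<Longrightarrow> subst \<sigma> M = subst \<tau> M"
proof (induction M arbitrary: \<sigma> \<tau>)
  case (Abs t)
  have "subst (case_nat (Var 0) (\<lambda>x. rename Suc (\<sigma> x))) t = subst (case_nat (Var 0) (\<lambda>x. rename Suc (\<tau> x))) t"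
  proof (rule Abs.IH)
    fix x assume "x \<in> FV t"
    with Abs.prems show "(case_nat (Var 0) (\<lambda>x. rename Suc (\<sigma> x))) x = (case_nat (Var 0) (\<lambda>x. rename Suc (\<tau> x))) x" by (cases x) auto
  qed
  then show ?case by simp
next
  case (App M N)
  have "subst \<sigma> M = subst \<tau> M" "subst \<sigma> N = subst \<tau> N"
    by (rule App.IH, simp add: App.prems)+
  then show ?case by simp
qed simp_all

lemma subst_rename: "subst \<sigma> (rename f M) = subst (\<lambda>x. \<sigma> (f x)) M"
proof (induction M arbitrary: f \<sigma>)
  case (Abs t)
  have "(\<lambda>x. case_nat (Var 0) (\<lambda>x. rename Suc (\<sigma> x)) (case_nat 0 (\<lambda>x. Suc (f x)) x))
      = case_nat (Var 0) (\<lambda>x. rename Suc (\<sigma> (f x)))"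
    by (rule ext) (simp split: nat.split)
  then show ?case by (simp add: Abs)
qed auto

lemma rename_subst: "rename f (subst \<sigma> M) = subst (\<lambda>x. rename f (\<sigma> x)) M"
proof (induction M arbitrary: f \<sigma>)
  case (Abs t)
  have "(\<lambda>x. rename (case_nat 0 (\<lambda>x. Suc (f x))) (case_nat (Var 0) (\<lambda>x. rename Suc (\<sigma> x)) x))
      = case_nat (Var 0) (\<lambda>x. rename Suc (rename f (\<sigma> x)))"
    by (rule ext) (simp add: rename_rename split: nat.split)
  then show ?case by (simp add: Abs)
qed auto

lemma FV_Lam: "FV (Lam x M) = FV M - {x}"
  by (auto simp: Lam_def FV_rename image_iff split: if_splits)

lemma Lam_eq_iff:
  "Lam x M = Lam y N \<longleftrightarrow> (x = y \<and> M = N) \<or> (x \<noteq> y \<and> y \<notin> FV M \<and> N = M\<lbrakk>x:=Var y\<rbrakk>)"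
proof -
  let ?c = "\<lambda>x y. if y = x then 0 else Suc y"
  let ?r = "\<lambda>z. if z = x then y else z"
  have r: "M\<lbrakk>x:=Var y\<rbrakk> = rename ?r M"
    by (auto simp: rename_conv_subst intro!: subst_cong)
  have N: "N = rename ?r M" if "rename (?c x) M = rename (?c y) N"
  proof -
    have "N = rename (case_nat y (\<lambda>z. z)) (rename (?c y) N)"
      by (simp add: rename_rename rename_id)
    also have "\<dots> = rename ?r M"
      unfolding that[symmetric] rename_rename by (rule rename_cong) simp
    finally show ?thesis .
  qed
  show ?thesis
  proof (cases "x = y")
    case True
    then show ?thesis using N by (auto simp: Lam_def rename_id)
  next
    case False
    have "y \<notin> FV M" if "rename (?c x) M = rename (?c y) N"
    proof
      assume "y \<in> FV M"
      then have "Suc y \<in> FV (rename (?c x) M)" using False by (auto simp: FV_rename image_iff)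
      then show False unfolding that by (auto simp: FV_rename split: if_splits)
    qed
    moreover have "rename (?c x) M = rename (?c y) (rename ?r M)" if "y \<notin> FV M"
      unfolding rename_rename using that by (intro rename_cong) auto
    ultimately show ?thesis using False N by (auto simp: Lam_def r)
  qed
qed

lemma Abs_is_Lam:
  assumes "finite A"
  shows "\<exists>x M. x \<notin> A \<and> Abs t = Lam x M"
proof -
  obtain x where x: "x \<notin> A \<union> FV (Abs t)"
    using ex_new_if_finite[of "A \<union> FV (Abs t)"] assms finite_FV by blast
  have "Lam x (rename (case_nat x (\<lambda>z. z)) t) = Abs t"
    using x by (auto simp: Lam_def rename_rename intro!: rename_id split: nat.split)
  with x show ?thesis by (metis UnI1)
qed

lemma subst_Lam:
  assumes "\<And>y. y \<in> FV M - {x} \<Longrightarrow> x \<notin> FV (\<sigma> y)"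
  shows "subst \<sigma> (Lam x M) = Lam x (subst (\<sigma>(x := Var x)) M)"
  using assms by (auto simp: Lam_def subst_rename rename_subst intro!: subst_cong rename_cong)


section \<open>Reduction\<close>

inductive beta :: "trm \<Rightarrow> trm \<Rightarrow> bool" where
  beta_rule: "beta (App (Lam x M) N) (M\<lbrakk>x:=N\<rbrakk>)"
| beta_Lam: "beta M N \<Longrightarrow> beta (Lam x M) (Lam x N)"
| beta_App1: "beta M M' \<Longrightarrow> beta (App M N) (App M' N)"
| beta_App2: "beta N N' \<Longrightarrow> beta (App M N) (App M N')"

definition whead :: "trm \<Rightarrow> trm \<Rightarrow> bool" where
  "whead M N \<longleftrightarrow> (\<exists>x P Q Qs. M = foldl App (App (Lam x P) Q) Qs \<and> N = foldl App (P\<lbrakk>x:=Q\<rbrakk>) Qs)"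


section \<open>Types\<close>

type_synonym atom = nat

text \<open>
  Modulo commutativity, associativity and idempotence of \<open>\<sqinter>\<close> and modulo neutrality of
  \<open>\<omega>\<close>, an element of the sort U is a finite intersection of elements of the sort T, i.e. a finite
  set of them. Thus \<open>ty\<close> is the sort T, \<open>uty\<close> is the sort U, \<open>\<omega>\<close> is the empty set, \<open>\<sqinter>\<close>
  is union, and \<open>ty\<close> is embedded into \<open>uty\<close> by singletons. The theorems
  \<open>raw_eqU_iff\<close>, \<open>raw_eqT_iff\<close>, \<open>uty_of_surj\<close> and \<open>ty_of_surj\<close>
  below show that this is the quotient of the raw type syntax.
\<close>

datatype ty = Atom atom | Arr "ty fset" ty  (infixr "\<rightarrow>" 60)

type_synonym uty = "ty fset"

abbreviation (input) Omega :: uty  ("\<omega>") where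
  "\<omega> \<equiv> {||}"

abbreviation (input) Meet :: "uty \<Rightarrow> uty \<Rightarrow> uty"  (infixl "\<sqinter>" 65) where
  "U \<sqinter> V \<equiv> U |\<union>| V"

subsection \<open>Adequacy of the representation\<close>

datatype raw_ty = RAtom atom | RArr raw_uty raw_ty
and raw_uty = ROmega | RMeet raw_uty raw_uty | RIncl raw_ty

inductive raw_eqT :: "raw_ty \<Rightarrow> raw_ty \<Rightarrow> bool"
  and raw_eqU :: "raw_uty \<Rightarrow> raw_uty \<Rightarrow> bool" where
  reflT: "raw_eqT t t"
| symT: "raw_eqT s t \<Longrightarrow> raw_eqT t s"
| transT: "raw_eqT r s \<Longrightarrow> raw_eqT s t \<Longrightarrow> raw_eqT r t"
| congArr: "raw_eqU u v \<Longrightarrow> raw_eqT s t \<Longrightarrow> raw_eqT (RArr u s) (RArr v t)"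
| reflU: "raw_eqU u u"
| symU: "raw_eqU u v \<Longrightarrow> raw_eqU v u"
| transU: "raw_eqU u v \<Longrightarrow> raw_eqU v w \<Longrightarrow> raw_eqU u w"
| congMeet: "raw_eqU u u' \<Longrightarrow> raw_eqU v v' \<Longrightarrow> raw_eqU (RMeet u v) (RMeet u' v')"
| congIncl: "raw_eqT s t \<Longrightarrow> raw_eqU (RIncl s) (RIncl t)"
| commU: "raw_eqU (RMeet u v) (RMeet v u)"
| assocU: "raw_eqU (RMeet (RMeet u v) w) (RMeet u (RMeet v w))"
| idemU: "raw_eqU (RMeet u u) u"
| unitU: "raw_eqU (RMeet ROmega u) u"

primrec ty_of :: "raw_ty \<Rightarrow> ty" and uty_of :: "raw_uty \<Rightarrow> uty" where
  "ty_of (RAtom a) = Atom a"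
| "ty_of (RArr u t) = uty_of u \<rightarrow> ty_of t"
| "uty_of ROmega = \<omega>"
| "uty_of (RMeet u v) = uty_of u \<sqinter> uty_of v"
| "uty_of (RIncl t) = {|ty_of t|}"

lemma raw_eq_sound:
  "raw_eqT s t \<Longrightarrow> ty_of s = ty_of t"
  "raw_eqU u v \<Longrightarrow> uty_of u = uty_of v"
  by (induction rule: raw_eqT_raw_eqU.inducts) auto

lemma raw_absorb1:
  assumes "\<And>c s t. c |\<in>| uty_of u \<Longrightarrow> ty_of s = c \<Longrightarrow> ty_of t = c \<Longrightarrow> raw_eqT s t"
    and "ty_of t |\<in>| uty_of u"
  shows "raw_eqU (RMeet (RIncl t) u) u"
  using assms
proof (induction u rule: raw_uty.induct[of "\<lambda>_. True"])
  case (RMeet u v)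
  from RMeet.prems(2) consider "ty_of t |\<in>| uty_of u" | "ty_of t |\<in>| uty_of v" by auto
  then show ?case
  proof cases
    case 1
    then have "raw_eqU (RMeet (RIncl t) u) u" using RMeet.IH(1) RMeet.prems(1) by auto
    then show ?thesis by (meson assocU congMeet reflU symU transU)
  next
    case 2
    then have "raw_eqU (RMeet (RIncl t) v) v" using RMeet.IH(2) RMeet.prems(1) by auto
    then have "raw_eqU (RMeet (RIncl t) (RMeet v u)) (RMeet v u)"
      by (meson assocU congMeet reflU symU transU)
    then show ?thesis by (meson commU congMeet reflU transU)
  qed
next
  case (RIncl s)
  then have "raw_eqT t s" by auto
  then show ?case by (meson congIncl congMeet idemU reflU transU)
qed auto

lemma raw_absorb:
  assumes "\<And>c s t. c |\<in>| uty_of u \<Longrightarrow> ty_of s = c \<Longrightarrow> ty_of t = c \<Longrightarrow> raw_eqT s t"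
    and "uty_of v |\<subseteq>| uty_of u"
  shows "raw_eqU (RMeet v u) u"
  using assms(2)
proof (induction v rule: raw_uty.induct[of "\<lambda>_. True"])
  case (RMeet v w)
  then have "raw_eqU (RMeet v u) u" "raw_eqU (RMeet w u) u" by auto
  then show ?case by (meson assocU congMeet reflU transU)
next
  case (RIncl t)
  then show ?case using raw_absorb1[OF assms(1)] by auto
qed (auto intro: unitU)

lemma raw_complete_aux:
  assumes "\<And>c s t. c |\<in>| uty_of u \<Longrightarrow> ty_of s = c \<Longrightarrow> ty_of t = c \<Longrightarrow> raw_eqT s t"
    and "uty_of u = uty_of v"
  shows "raw_eqU u v"
proof -
  have "raw_eqU (RMeet v u) u" using assms by (intro raw_absorb) auto
  moreover have "raw_eqU (RMeet u v) v" using assms by (intro raw_absorb) auto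
  ultimately show ?thesis by (meson commU symU transU)
qed

lemma raw_completeT: "ty_of s = c \<Longrightarrow> ty_of t = c \<Longrightarrow> raw_eqT s t"
proof (induction c arbitrary: s t)
  case (Atom a)
  then show ?case by (cases s; cases t) (auto intro: reflT)
next
  case (Arr F c)
  from Arr.prems obtain u s' v t' where
    *: "s = RArr u s'" "t = RArr v t'" "uty_of u = F" "uty_of v = F" "ty_of s' = c" "ty_of t' = c"
    by (cases s; cases t) auto
  have "raw_eqU u v" using * Arr.IH(1) by (intro raw_complete_aux) auto
  with * Arr.IH(2) show ?case by (auto intro: congArr)
qed

theorem raw_eqT_iff: "raw_eqT s t \<longleftrightarrow> ty_of s = ty_of t"
  using raw_eq_sound(1) raw_completeT by blast

theorem raw_eqU_iff: "raw_eqU u v \<longleftrightarrow> uty_of u = uty_of v"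
  using raw_eq_sound(2) raw_complete_aux raw_completeT by blast

lemma uty_of_surj_aux: "(\<And>T. T |\<in>| U \<Longrightarrow> \<exists>t. ty_of t = T) \<Longrightarrow> \<exists>u. uty_of u = U"
proof (induction U)
  case empty
  show ?case by (rule exI[of _ ROmega]) simp
next
  case (insert T U)
  from insert.prems obtain t where "ty_of t = T" by blast
  moreover from insert obtain u where "uty_of u = U" by blast
  ultimately show ?case by (intro exI[of _ "RMeet (RIncl t) u"]) simp
qed

theorem ty_of_surj: "\<exists>t. ty_of t = T"
proof (induction T)
  case (Atom a)
  show ?case by (rule exI[of _ "RAtom a"]) simp
next
  case (Arr U T)
  then obtain u t where "uty_of u = U" "ty_of t = T" using uty_of_surj_aux by blast
  then show ?case by (intro exI[of _ "RArr u t"]) simp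
qed

theorem uty_of_surj: "\<exists>u. uty_of u = U"
  using uty_of_surj_aux ty_of_surj by blast


section \<open>Environments\<close>

type_synonym env = "(var, uty) fmap"

context includes fmap.lifting
begin

lift_definition env_omega :: "trm \<Rightarrow> env" is
  "\<lambda>M x. if x \<in> FV M then Some \<omega> else None"
  by (simp add: dom_def finite_FV)

lift_definition env_meet :: "env \<Rightarrow> env \<Rightarrow> env"  (infixl "\<sqinter>\<^sub>e" 65) is
  "\<lambda>\<Gamma>\<^sub>1 \<Gamma>\<^sub>2 x. case \<Gamma>\<^sub>1 x of
      None \<Rightarrow> \<Gamma>\<^sub>2 x
    | Some U \<Rightarrow> (case \<Gamma>\<^sub>2 x of None \<Rightarrow> Some U | Some V \<Rightarrow> Some (U \<sqinter> V))"
  subgoal for \<Gamma>\<^sub>1 \<Gamma>\<^sub>2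
    by (rule finite_subset[of _ "dom \<Gamma>\<^sub>1 \<union> dom \<Gamma>\<^sub>2"]) (auto split: option.splits)
  done

end


section \<open>Subtyping\<close>

text \<open>
  The relation is defined on three syntactic categories. No rule for types has a premise on
  environments, and no rule for environments has a premise on typings, so the least relation
  splits into three successive inductive definitions.
\<close>

inductive sub_uty :: "uty \<Rightarrow> uty \<Rightarrow> bool"  (infix "\<sqsubseteq>" 50) where
  sub_refl: "U \<sqsubseteq> U"
| sub_trans: "U \<sqsubseteq> V \<Longrightarrow> V \<sqsubseteq> W \<Longrightarrow> U \<sqsubseteq> W"
| sub_meetE: "U\<^sub>1 \<sqinter> U\<^sub>2 \<sqsubseteq> U\<^sub>1"
| sub_meet: "U\<^sub>1 \<sqsubseteq> V\<^sub>1 \<Longrightarrow> U\<^sub>2 \<sqsubseteq> V\<^sub>2 \<Longrightarrow> U\<^sub>1 \<sqinter> U\<^sub>2 \<sqsubseteq> V\<^sub>1 \<sqinter> V\<^sub>2"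
| sub_arr: "U\<^sub>2 \<sqsubseteq> U\<^sub>1 \<Longrightarrow> {|T\<^sub>1|} \<sqsubseteq> {|T\<^sub>2|} \<Longrightarrow> {|U\<^sub>1 \<rightarrow> T\<^sub>1|} \<sqsubseteq> {|U\<^sub>2 \<rightarrow> T\<^sub>2|}"

inductive sub_env :: "env \<Rightarrow> env \<Rightarrow> bool"  (infix "\<sqsubseteq>\<^sub>e" 50) where
  sub_env_refl: "\<Gamma> \<sqsubseteq>\<^sub>e \<Gamma>"
| sub_env_trans: "\<Gamma> \<sqsubseteq>\<^sub>e \<Delta> \<Longrightarrow> \<Delta> \<sqsubseteq>\<^sub>e \<Theta> \<Longrightarrow> \<Gamma> \<sqsubseteq>\<^sub>e \<Theta>"
| sub_env_upd: "U\<^sub>1 \<sqsubseteq> U\<^sub>2 \<Longrightarrow> x |\<notin>| fmdom \<Gamma> \<Longrightarrow> fmupd x U\<^sub>1 \<Gamma> \<sqsubseteq>\<^sub>e fmupd x U\<^sub>2 \<Gamma>"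

inductive sub_typing :: "env \<times> uty \<Rightarrow> env \<times> uty \<Rightarrow> bool"  (infix "\<sqsubseteq>\<^sub>t" 50) where
  sub_typing_refl: "\<Phi> \<sqsubseteq>\<^sub>t \<Phi>"
| sub_typing_trans: "\<Phi>\<^sub>1 \<sqsubseteq>\<^sub>t \<Phi>\<^sub>2 \<Longrightarrow> \<Phi>\<^sub>2 \<sqsubseteq>\<^sub>t \<Phi>\<^sub>3 \<Longrightarrow> \<Phi>\<^sub>1 \<sqsubseteq>\<^sub>t \<Phi>\<^sub>3"
| sub_typing_rule: "U\<^sub>1 \<sqsubseteq> U\<^sub>2 \<Longrightarrow> \<Gamma>\<^sub>2 \<sqsubseteq>\<^sub>e \<Gamma>\<^sub>1 \<Longrightarrow> (\<Gamma>\<^sub>1, U\<^sub>1) \<sqsubseteq>\<^sub>t (\<Gamma>\<^sub>2, U\<^sub>2)"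


section \<open>Typing\<close>

inductive typing :: "trm \<Rightarrow> env \<Rightarrow> uty \<Rightarrow> bool"  ("_ : \<langle>_ \<turnstile> _\<rangle>" [51, 51, 51] 50) where
  ax: "Var x : \<langle>fmupd x {|T|} fmempty \<turnstile> {|T|}\<rangle>"
| omega: "M : \<langle>env_omega M \<turnstile> \<omega>\<rangle>"
| arr_i: "M : \<langle>fmupd x U \<Gamma> \<turnstile> {|T|}\<rangle> \<Longrightarrow> x |\<notin>| fmdom \<Gamma> \<Longrightarrow> Lam x M : \<langle>\<Gamma> \<turnstile> {|U \<rightarrow> T|}\<rangle>"
| arr_i': "M : \<langle>\<Gamma> \<turnstile> {|T|}\<rangle> \<Longrightarrow> x |\<notin>| fmdom \<Gamma> \<Longrightarrow> Lam x M : \<langle>\<Gamma> \<turnstile> {|\<omega> \<rightarrow> T|}\<rangle>"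
| arr_e: "M\<^sub>1 : \<langle>\<Gamma>\<^sub>1 \<turnstile> {|U \<rightarrow> T|}\<rangle> \<Longrightarrow> M\<^sub>2 : \<langle>\<Gamma>\<^sub>2 \<turnstile> U\<rangle> \<Longrightarrow> App M\<^sub>1 M\<^sub>2 : \<langle>\<Gamma>\<^sub>1 \<sqinter>\<^sub>e \<Gamma>\<^sub>2 \<turnstile> {|T|}\<rangle>"
| meet_i: "M : \<langle>\<Gamma> \<turnstile> U\<^sub>1\<rangle> \<Longrightarrow> M : \<langle>\<Gamma> \<turnstile> U\<^sub>2\<rangle> \<Longrightarrow> M : \<langle>\<Gamma> \<turnstile> U\<^sub>1 \<sqinter> U\<^sub>2\<rangle>"
| subsumption: "M : \<langle>\<Gamma> \<turnstile> U\<rangle> \<Longrightarrow> (\<Gamma>, U) \<sqsubseteq>\<^sub>t (\<Gamma>', U') \<Longrightarrow> M : \<langle>\<Gamma>' \<turnstile> U'\<rangle>"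


section \<open>Realisability semantics\<close>

definition leads_to :: "trm set \<Rightarrow> trm set \<Rightarrow> trm set"  (infixr "\<leadsto>" 60) where
  "X \<leadsto> Y = {M. \<forall>N\<in>X. App M N \<in> Y}"

definition saturated :: "(trm \<Rightarrow> trm \<Rightarrow> bool) \<Rightarrow> trm set \<Rightarrow> bool" where
  "saturated r X \<longleftrightarrow> (\<forall>M N. r\<^sup>*\<^sup>* M N \<longrightarrow> N \<in> X \<longrightarrow> M \<in> X)"

definition interpretation_of :: "(trm \<Rightarrow> trm \<Rightarrow> bool) \<Rightarrow> (atom \<Rightarrow> trm set) \<Rightarrow> bool" where
  "interpretation_of r I \<longleftrightarrow> (\<forall>a. saturated r (I a))"

primrec sem_ty :: "(atom \<Rightarrow> trm set) \<Rightarrow> ty \<Rightarrow> trm set" where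
  "sem_ty I (Atom a) = I a"
| "sem_ty I (U \<rightarrow> T) = \<Inter> (fset (sem_ty I |`| U)) \<leadsto> sem_ty I T"

definition sem :: "(atom \<Rightarrow> trm set) \<Rightarrow> uty \<Rightarrow> trm set" where
  "sem I U = (\<Inter>T\<in>fset U. sem_ty I T)"

lemma sem_Atom: "sem I {|Atom a|} = I a"
  and sem_Omega: "sem I \<omega> = UNIV"
  and sem_Meet: "sem I (U \<sqinter> V) = sem I U \<inter> sem I V"
  and sem_Arr: "sem I {|U \<rightarrow> T|} = sem I U \<leadsto> sem I {|T|}"
  by (auto simp: sem_def)

end

theory Submission
  imports Defs "HOL-Library.Countable"
begin

text \<open>
  Typability of \<open>M\<close> by a single type \<open>T\<close>, under an environment \<open>E\<close> that is total on the
  variables, has a syntax-directed description \<open>has_ty M E T\<close> by recursion on \<open>M\<close>, which is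
  stable under weakening and under beta expansion. Fix a surjection \<open>G\<close> from variables onto
  types. Then \<open>I a = {M. has_ty M G (Atom a)}\<close> is a saturated interpretation, and by induction on
  \<open>T\<close> the meaning of every \<open>T\<close> is \<open>{M. has_ty M G T}\<close>: if \<open>M N\<close> has type \<open>T\<close> whenever \<open>N\<close> has type
  \<open>U\<close>, apply this to a variable \<open>N\<close> with \<open>G N = U\<close>. Instantiating the hypothesis with variables
  \<open>y i\<close> such that \<open>G (y i)\<close> is the type of \<open>x i\<close> yields the typing of \<open>M\<close>. Since \<open>G\<close> is total, no
  freshness condition on the variables is needed.
\<close>

section \<open>Subtyping\<close>

lemma sub_fsubset: "V |\<subseteq>| U \<Longrightarrow> U \<sqsubseteq> V"
  by (metis sub_meetE sup.absorb_iff1 sup_commute)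

lemma sub_greatest: "(\<And>T. T |\<in>| V \<Longrightarrow> U \<sqsubseteq> {|T|}) \<Longrightarrow> U \<sqsubseteq> V"
proof (induction V)
  case empty
  show ?case by (rule sub_fsubset) simp
next
  case (insert T V)
  then have "U |\<union>| U \<sqsubseteq> {|T|} |\<union>| V" by (intro sub_meet) auto
  then show ?case by simp
qed

text \<open>Each member on the right is traced back to a single member on the left. Both sides are
  arbitrary intersections because the middle type of \<open>sub_trans\<close> can be one even when
  the outer types are single.\<close>

lemma sub_member:
  assumes "U \<sqsubseteq> V" "T |\<in>| V"
  shows "\<exists>S. S |\<in>| U \<and> (S = T \<or> (\<exists>U\<^sub>1 T\<^sub>1 U\<^sub>2 T\<^sub>2.
           S = U\<^sub>1 \<rightarrow> T\<^sub>1 \<and> T = U\<^sub>2 \<rightarrow> T\<^sub>2 \<and> U\<^sub>2 \<sqsubseteq> U\<^sub>1 \<and> {|T\<^sub>1|} \<sqsubseteq> {|T\<^sub>2|}))"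
  using assms
proof (induction arbitrary: T rule: sub_uty.induct)
  case (sub_trans U V W)
  obtain S where S: "S |\<in>| V" "S = T \<or> (\<exists>U\<^sub>1 T\<^sub>1 U\<^sub>2 T\<^sub>2.
      S = U\<^sub>1 \<rightarrow> T\<^sub>1 \<and> T = U\<^sub>2 \<rightarrow> T\<^sub>2 \<and> U\<^sub>2 \<sqsubseteq> U\<^sub>1 \<and> {|T\<^sub>1|} \<sqsubseteq> {|T\<^sub>2|})"
    using sub_trans.IH(2)[OF sub_trans.prems] by blast
  obtain R where R: "R |\<in>| U" "R = S \<or> (\<exists>U\<^sub>1 T\<^sub>1 U\<^sub>2 T\<^sub>2.
      R = U\<^sub>1 \<rightarrow> T\<^sub>1 \<and> S = U\<^sub>2 \<rightarrow> T\<^sub>2 \<and> U\<^sub>2 \<sqsubseteq> U\<^sub>1 \<and> {|T\<^sub>1|} \<sqsubseteq> {|T\<^sub>2|})"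
    using sub_trans.IH(1)[OF S(1)] by blast
  from R S(2) show ?case
    by (intro exI[of _ R]) (auto intro: sub_uty.sub_trans)
qed (fastforce intro: sub_refl)+

lemma sub_arrD:
  assumes "{|U \<rightarrow> S|} \<sqsubseteq> {|T|}"
  obtains U' T' where "T = U' \<rightarrow> T'" "U' \<sqsubseteq> U" "{|S|} \<sqsubseteq> {|T'|}"
  using sub_member[OF assms, of T] by (auto intro: sub_refl)

section \<open>Syntax-directed typing\<close>

text \<open>Subtyping enters only at variables, and an argument is checked against each member of
  \<open>V\<close> separately, so \<open>V\<close> empty is the case of \<omega>.\<close>

primrec has_ty :: "trm \<Rightarrow> (var \<Rightarrow> uty) \<Rightarrow> ty \<Rightarrow> bool" where
  "has_ty (Var x) E T \<longleftrightarrow> E x \<sqsubseteq> {|T|}"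
| "has_ty (App M N) E T \<longleftrightarrow> (\<exists>V. has_ty M E (V \<rightarrow> T) \<and> (\<forall>S. S |\<in>| V \<longrightarrow> has_ty N E S))"
| "has_ty (Abs t) E T \<longleftrightarrow> (\<exists>U T'. T = U \<rightarrow> T' \<and> has_ty t (case_nat U E) T')"

text \<open>Subsumption is admissible. The environment varies in the induction because under a
  binder contravariance replaces \<open>U\<close> by the smaller \<open>U'\<close>.\<close>

lemma has_ty_weaken:
  "has_ty M E S \<Longrightarrow> (\<And>x. E' x \<sqsubseteq> E x) \<Longrightarrow> {|S|} \<sqsubseteq> {|T|} \<Longrightarrow> has_ty M E' T"
proof (induction M arbitrary: E E' S T)
  case (Var x)
  then show ?case by (auto intro: sub_trans)
next
  case (App M N)
  then obtain V where V: "has_ty M E (V \<rightarrow> S)" "\<And>R. R |\<in>| V \<Longrightarrow> has_ty N E R" by auto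
  have "has_ty M E' (V \<rightarrow> T)"
    using V(1) App.prems(2,3) by (auto intro: App.IH(1) sub_arr sub_refl)
  moreover have "has_ty N E' R" if "R |\<in>| V" for R
    using V(2)[OF that] App.prems(2) by (auto intro: App.IH(2) sub_refl)
  ultimately show ?case by auto
next
  case (Abs t)
  then obtain U S' where S: "S = U \<rightarrow> S'" "has_ty t (case_nat U E) S'" by auto
  obtain U' T' where T: "T = U' \<rightarrow> T'" "U' \<sqsubseteq> U" "{|S'|} \<sqsubseteq> {|T'|}"
    using Abs.prems(3) unfolding S by (rule sub_arrD)
  have "has_ty t (case_nat U' E') T'"
    using S(2) by (rule Abs.IH) (use T Abs.prems(2) in \<open>auto split: nat.split\<close>)
  with T show ?case by simp
qed

lemma has_ty_rename: "has_ty (rename f M) E T \<longleftrightarrow> has_ty M (\<lambda>x. E (f x)) T"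
proof (induction M arbitrary: f E T)
  case (Abs t)
  have "(\<lambda>x. case_nat U E (case_nat 0 (\<lambda>x. Suc (f x)) x)) = case_nat U (\<lambda>x. E (f x))" for U
    by (rule ext) (simp split: nat.split)
  then show ?case by (simp add: Abs)
qed auto

lemma has_ty_Lam: "has_ty (Lam x M) E T \<longleftrightarrow> (\<exists>U T'. T = U \<rightarrow> T' \<and> has_ty M (E(x := U)) T')"
proof -
  have "(\<lambda>y. case_nat U E (if y = x then 0 else Suc y)) = E(x := U)" for U
    by (rule ext) simp
  then show ?thesis by (simp add: Lam_def has_ty_rename)
qed

text \<open>Inverse substitution lemma, the core of expansion: \<open>F x\<close> gathers the
  finitely many types that the copies of \<open>\<sigma> x\<close> receive.\<close>

lemma has_ty_subst:
  "has_ty (subst \<sigma> M) E T \<Longrightarrow> \<exists>F. has_ty M F T \<and> (\<forall>x S. S |\<in>| F x \<longrightarrow> has_ty (\<sigma> x) E S)"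
proof (induction M arbitrary: \<sigma> E T)
  case (Var x)
  then show ?case by (intro exI[of _ "(\<lambda>_. {||})(x := {|T|})"]) (auto intro: sub_refl)
next
  case (App M N)
  then obtain V where V: "has_ty (subst \<sigma> M) E (V \<rightarrow> T)" "\<And>S. S |\<in>| V \<Longrightarrow> has_ty (subst \<sigma> N) E S"
    by auto
  obtain F where F: "has_ty M F (V \<rightarrow> T)" "\<And>x S. S |\<in>| F x \<Longrightarrow> has_ty (\<sigma> x) E S"
    using App.IH(1)[OF V(1)] by blast
  have "\<exists>H. \<forall>S. S |\<in>| V \<longrightarrow> has_ty N (H S) S \<and> (\<forall>x R. R |\<in>| H S x \<longrightarrow> has_ty (\<sigma> x) E R)"
    using App.IH(2)[OF V(2)] by metis
  then obtain H where H: "\<And>S. S |\<in>| V \<Longrightarrow> has_ty N (H S) S"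
      "\<And>S x R. S |\<in>| V \<Longrightarrow> R |\<in>| H S x \<Longrightarrow> has_ty (\<sigma> x) E R"
    by metis
  \<comment> \<open>The argument needs one environment per member of \<open>V\<close>;
    \<open>K\<close> is their intersection with \<open>F\<close>, finite at each variable since
    \<open>V\<close> is finite.\<close>
  define K where "K = (\<lambda>x. F x |\<union>| ffUnion ((\<lambda>S. H S x) |`| V))"
  have "has_ty M K (V \<rightarrow> T)"
    using F(1) by (rule has_ty_weaken) (auto simp: K_def intro: sub_fsubset sub_refl)
  moreover have "has_ty N K S" if "S |\<in>| V" for S
    using H(1)[OF that] by (rule has_ty_weaken)
      (use that in \<open>auto simp: K_def ffUnion.rep_eq intro!: sub_fsubset sub_refl\<close>)
  moreover have "has_ty (\<sigma> x) E R" if "R |\<in>| K x" for x R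
    using that F(2) H(2) by (auto simp: K_def ffUnion.rep_eq)
  ultimately show ?case by auto
next
  case (Abs t)
  then obtain U T' where T: "T = U \<rightarrow> T'"
    "has_ty (subst (case_nat (Var 0) (\<lambda>x. rename Suc (\<sigma> x))) t) (case_nat U E) T'"
    by auto
  obtain F where F: "has_ty t F T'"
    "\<And>x S. S |\<in>| F x \<Longrightarrow> has_ty (case_nat (Var 0) (\<lambda>x. rename Suc (\<sigma> x)) x) (case_nat U E) S"
    using Abs.IH[OF T(2)] by blast
  \<comment> \<open>Index 0 is substituted by itself, so every member of \<open>F 0\<close> is a
    type of \<open>Var 0\<close>, that is, a supertype of \<open>U\<close>.\<close>
  have "U \<sqsubseteq> F 0" using F(2)[of _ 0] by (auto intro: sub_greatest[of "F 0"])
  then have "has_ty t (case_nat U (\<lambda>x. F (Suc x))) T'"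
    by (intro has_ty_weaken[OF F(1)]) (simp_all add: sub_refl split: nat.split)
  moreover have "has_ty (\<sigma> x) E S" if "S |\<in>| F (Suc x)" for x S
    using F(2)[OF that] by (simp add: has_ty_rename)
  ultimately show ?case using T(1) by auto
qed

section \<open>Expansion\<close>

text \<open>For a redex, the set \<open>F x\<close> given by \<open>has_ty_subst\<close> serves as
  the argument type: \<open>N\<close> has all its members.\<close>

lemma beta_expansion: "beta M N \<Longrightarrow> has_ty N E T \<Longrightarrow> has_ty M E T"
proof (induction arbitrary: E T rule: beta.induct)
  case (beta_rule x M N)
  obtain F where F: "has_ty M F T" "\<And>y S. S |\<in>| F y \<Longrightarrow> has_ty ((Var(x := N)) y) E S"
    using has_ty_subst[OF beta_rule] by blast
  have "E y \<sqsubseteq> F y" if "y \<noteq> x" for y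
    using F(2)[of _ y] that by (auto intro: sub_greatest[of "F y"])
  then have "has_ty M (E(x := F x)) T"
    by (intro has_ty_weaken[OF F(1)]) (auto intro: sub_refl)
  then show ?case using F(2)[of _ x] by (auto simp: has_ty_Lam)
next
  case (beta_Lam M N x)
  then show ?case by (auto simp: has_ty_Lam)
next
  case (beta_App1 M M' N)
  then show ?case by auto
next
  case (beta_App2 N N' M)
  then show ?case by auto
qed

lemma beta_foldl_App: "beta M N \<Longrightarrow> beta (foldl App M Qs) (foldl App N Qs)"
  by (induction Qs arbitrary: M N) (auto intro: beta_App1)

text \<open>Stability under beta expansion therefore settles both choices of
  \<open>r\<close>.\<close>

lemma whead_imp_beta: "whead M N \<Longrightarrow> beta M N"
  by (auto simp: whead_def intro: beta_foldl_App beta_rule)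

section \<open>Adequacy of the syntax-directed typing\<close>

context includes fmap.lifting
begin

text \<open>Restriction to \<open>FV M\<close> matches the typing rules, whose environments have
  exactly the free variables as domain.\<close>

lift_definition env_of :: "(var \<Rightarrow> uty) \<Rightarrow> trm \<Rightarrow> env" is
  "\<lambda>E M x. if x \<in> FV M then Some (E x) else None"
  by (simp add: dom_def finite_FV)

lemma fmlookup_env_of: "fmlookup (env_of E M) x = (if x \<in> FV M then Some (E x) else None)"
  by transfer simp

lemma env_of_omega: "env_of (\<lambda>_. {||}) M = env_omega M"
  by transfer simp

lemma env_of_App: "env_of E (App M N) = env_of E M \<sqinter>\<^sub>e env_of E N"
  by transfer auto

end

lemma fmdom_env_of: "x |\<in>| fmdom (env_of E M) \<longleftrightarrow> x \<in> FV M"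
  by (simp add: fmlookup_dom_iff fmlookup_env_of)

text \<open>\<open>sub_env_upd\<close> changes one declaration at a time, so the variables are sent
  to \<omega> one by one along a finite set \<open>A\<close>, finally \<open>FV M\<close>.\<close>

lemma sub_env_of_omega: "env_of E M \<sqsubseteq>\<^sub>e env_omega M"
proof -
  have "env_of E M \<sqsubseteq>\<^sub>e env_of (\<lambda>x. if x \<in> A then {||} else E x) M" if "finite A" for A
    using that
  proof (induction A)
    case empty
    then show ?case by (simp add: sub_env_refl)
  next
    case (insert x A)
    let ?E = "\<lambda>A x. if x \<in> A then {||} else E x"
    let ?\<Gamma> = "fmdrop x (env_of (?E A) M)"
    have "env_of (?E A) M \<sqsubseteq>\<^sub>e env_of (?E (insert x A)) M"
    proof (cases "x \<in> FV M")
      case True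
      have "env_of (?E A) M = fmupd x (?E A x) ?\<Gamma>"
        "env_of (?E (insert x A)) M = fmupd x {||} ?\<Gamma>"
        using True by (auto intro!: fmap_ext simp: fmlookup_env_of)
      moreover have "fmupd x (?E A x) ?\<Gamma> \<sqsubseteq>\<^sub>e fmupd x {||} ?\<Gamma>"
        by (intro sub_env_upd sub_fsubset) auto
      ultimately show ?thesis by simp
    next
      case False
      then have "env_of (?E A) M = env_of (?E (insert x A)) M"
        by (auto intro!: fmap_ext simp: fmlookup_env_of)
      then show ?thesis by (simp add: sub_env_refl)
    qed
    with insert.IH show ?case by (rule sub_env_trans)
  qed
  from this[OF finite_FV[of M]] have "env_of E M \<sqsubseteq>\<^sub>e env_of (\<lambda>x. if x \<in> FV M then {||} else E x) M" .
  also have "env_of (\<lambda>x. if x \<in> FV M then {||} else E x) M = env_of (\<lambda>_. {||}) M"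
    by (auto intro!: fmap_ext simp: fmlookup_env_of)
  finally show ?thesis by (simp add: env_of_omega)
qed

lemma typing_sub: "M : \<langle>\<Gamma> \<turnstile> U\<rangle> \<Longrightarrow> U \<sqsubseteq> V \<Longrightarrow> \<Delta> \<sqsubseteq>\<^sub>e \<Gamma> \<Longrightarrow> M : \<langle>\<Delta> \<turnstile> V\<rangle>"
  by (blast intro: subsumption sub_typing_rule)

lemma typing_all:
  "(\<And>T. T |\<in>| U \<Longrightarrow> M : \<langle>env_of E M \<turnstile> {|T|}\<rangle>) \<Longrightarrow> M : \<langle>env_of E M \<turnstile> U\<rangle>"
proof (induction U)
  case empty
  show ?case by (rule typing_sub[OF omega sub_refl sub_env_of_omega])
next
  case (insert T U)
  then have "M : \<langle>env_of E M \<turnstile> {|T|} |\<union>| U\<rangle>" by (intro meet_i) auto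
  then show ?case by simp
qed

text \<open>The typing rules know only \<open>Lam\<close>, so the nameless binder is given a name:
  index 0 becomes \<open>x\<close>, and freshness keeps it apart from the images under
  \<open>f\<close>.\<close>

lemma rename_Abs_Lam:
  assumes "x \<notin> FV (rename f (Abs t))"
  shows "rename f (Abs t) = Lam x (rename (case_nat x f) t)"
proof -
  have "f y \<noteq> x" if "Suc y \<in> FV t" for y
    using that assms unfolding FV_rename by auto
  then show ?thesis
    by (fastforce simp: Lam_def rename_rename intro!: rename_cong split: nat.split)
qed

text \<open>The renaming makes room for the induction hypothesis to open a binder with a fresh name.\<close>

lemma has_ty_imp_typing_rename:
  "has_ty M F T \<Longrightarrow> (\<And>y. y \<in> FV M \<Longrightarrow> F y = E (f y)) \<Longrightarrow>
    rename f M : \<langle>env_of E (rename f M) \<turnstile> {|T|}\<rangle>"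
proof (induction M arbitrary: f F E T)
  case (Var x)
  have "env_of E (Var (f x)) = fmupd (f x) (E (f x)) fmempty"
    by (auto intro!: fmap_ext simp: fmlookup_env_of)
  \<comment> \<open>\<open>ax\<close> yields single types only; the whole intersection
    \<open>E (f x)\<close> is assembled first and then weakened to \<open>T\<close>.\<close>
  moreover have "Var (f x) : \<langle>fmupd (f x) U fmempty \<turnstile> U\<rangle>" for U
  proof (induction U)
    case empty
    have "env_omega (Var (f x)) = fmupd (f x) {||} fmempty"
      by (auto intro!: fmap_ext simp: env_of_omega[symmetric] fmlookup_env_of)
    then show ?case using omega[of "Var (f x)"] by simp
  next
    case (insert S U)
    have "Var (f x) : \<langle>fmupd (f x) (finsert S U) fmempty \<turnstile> {|S|} |\<union>| U\<rangle>"
      by (intro meet_i typing_sub[OF ax] typing_sub[OF insert.IH] sub_refl sub_env_upd)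
        (auto intro: sub_fsubset)
    then show ?case by simp
  qed
  ultimately show ?case using Var by (auto intro: typing_sub sub_env_refl)
next
  case (App M N)
  then obtain V where V: "has_ty M F (V \<rightarrow> T)" "\<And>S. S |\<in>| V \<Longrightarrow> has_ty N F S" by auto
  have "rename f M : \<langle>env_of E (rename f M) \<turnstile> {|V \<rightarrow> T|}\<rangle>"
    using V(1) by (rule App.IH(1)) (simp add: App.prems(2))
  moreover have "rename f N : \<langle>env_of E (rename f N) \<turnstile> V\<rangle>"
  proof (rule typing_all)
    fix S assume "S |\<in>| V"
    from V(2)[OF this] show "rename f N : \<langle>env_of E (rename f N) \<turnstile> {|S|}\<rangle>"
      by (rule App.IH(2)) (simp add: App.prems(2))
  qed
  ultimately show ?case by (auto simp: env_of_App intro: arr_e)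
next
  case (Abs t)
  then obtain U T' where T: "T = U \<rightarrow> T'" "has_ty t (case_nat U F) T'" by auto
  obtain x where x: "x \<notin> FV (rename f (Abs t))"
    using ex_new_if_finite[OF _ finite_FV] by blast
  define N where "N = rename (case_nat x f) t"
  have L: "rename f (Abs t) = Lam x N"
    unfolding N_def using x by (rule rename_Abs_Lam)
  have fresh: "f y \<noteq> x" if "Suc y \<in> FV t" for y
    using that x unfolding FV_rename by auto
  have N: "N : \<langle>env_of (E(x := U)) N \<turnstile> {|T'|}\<rangle>"
    unfolding N_def using T(2)
    by (rule Abs.IH) (use Abs.prems(2) fresh in \<open>auto split: nat.split\<close>)
  have new: "x |\<notin>| fmdom (env_of E (Lam x N))" by (simp add: fmdom_env_of FV_Lam)
  show ?case unfolding L T(1)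
  proof (cases "x \<in> FV N")
    case True
    then have "env_of (E(x := U)) N = fmupd x U (env_of E (Lam x N))"
      by (auto intro!: fmap_ext simp: fmlookup_env_of FV_Lam)
    with N new show "Lam x N : \<langle>env_of E (Lam x N) \<turnstile> {|U \<rightarrow> T'|}\<rangle>" by (auto intro: arr_i)
  next
    case False
    then have "env_of (E(x := U)) N = env_of E (Lam x N)"
      by (auto intro!: fmap_ext simp: fmlookup_env_of FV_Lam)
    \<comment> \<open>The bound variable does not occur, so the rule yields argument type \<omega>;
      contravariance then allows any \<open>U\<close>.\<close>
    with N new have "Lam x N : \<langle>env_of E (Lam x N) \<turnstile> {|{||} \<rightarrow> T'|}\<rangle>" by (auto intro: arr_i')
    then show "Lam x N : \<langle>env_of E (Lam x N) \<turnstile> {|U \<rightarrow> T'|}\<rangle>"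
      by (rule typing_sub) (auto intro: sub_arr sub_fsubset sub_refl sub_env_refl)
  qed
qed

lemma has_ty_imp_typing: "has_ty M E T \<Longrightarrow> M : \<langle>env_of E M \<turnstile> {|T|}\<rangle>"
  using has_ty_imp_typing_rename[of M E T E "\<lambda>x. x"] by (simp add: rename_id)

section \<open>The term model\<close>

instance raw_ty :: countable by countable_datatype
instance raw_uty :: countable by countable_datatype

text \<open>The raw syntax is countable and \<open>uty_of\<close> maps it onto the types.\<close>

lemma ex_surj_uty: "\<exists>G :: var \<Rightarrow> uty. surj G"
proof
  have "surj uty_of" using uty_of_surj by (metis surjI)
  then show "surj (uty_of \<circ> from_nat)" using surj_from_nat by (rule comp_surj[rotated])
qed

lemma saturated_has_ty:
  assumes "r \<in> {whead, beta}"
  shows "saturated r {M. has_ty M E T}"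
proof -
  have "has_ty M E T" if "r\<^sup>*\<^sup>* M N" "has_ty N E T" for M N
    using that
    by (induction rule: converse_rtranclp_induct) (use assms in \<open>auto dest: whead_imp_beta beta_expansion\<close>)
  then show ?thesis by (auto simp: saturated_def)
qed

lemma sem_ty_term_model:
  assumes "surj G"
  shows "sem_ty (\<lambda>a. {M. has_ty M G (Atom a)}) T = {M. has_ty M G T}"
proof (induction T)
  case (Atom a)
  show ?case by simp
next
  case (Arr U T)
  have "has_ty M G (U \<rightarrow> T)"
    if "\<And>N. (\<And>S. S |\<in>| U \<Longrightarrow> has_ty N G S) \<Longrightarrow> has_ty (App M N) G T" for M
  proof -
    obtain x where x: "G x = U" using assms by (metis surjD)
    have "has_ty (App M (Var x)) G T"
      using x by (intro that) (auto intro: sub_fsubset)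
    \<comment> \<open>The types of \<open>Var x\<close> under \<open>G\<close> are the supertypes of
      \<open>U\<close>, so inverting the application gives an argument type \<open>V\<close> above
      \<open>U\<close>.\<close>
    then obtain V where V: "has_ty M G (V \<rightarrow> T)" "\<And>S. S |\<in>| V \<Longrightarrow> U \<sqsubseteq> {|S|}" using x by auto
    have "U \<sqsubseteq> V" using V(2) by (rule sub_greatest)
    then show ?thesis
      by (intro has_ty_weaken[OF V(1)] sub_arr sub_refl)
  qed
  then show ?case using Arr by (auto simp: leads_to_def)
qed

lemma sem_term_model:
  assumes "surj G"
  shows "sem (\<lambda>a. {M. has_ty M G (Atom a)}) U = {M. \<forall>T. T |\<in>| U \<longrightarrow> has_ty M G T}"
  by (auto simp: sem_def sem_ty_term_model[OF assms])

theorem theorem4p10: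
  fixes r :: "trm \<Rightarrow> trm \<Rightarrow> bool"
    and xs :: "var list" and Us :: "uty list" and U :: uty and M :: trm
  assumes "r \<in> {whead, beta}"
    and "distinct xs" and "length Us = length xs"
    and "FV M = set xs"
    and "\<And>I Ns. interpretation_of r I \<Longrightarrow> length Ns = length xs \<Longrightarrow>
           (\<forall>i<length xs. Ns ! i \<in> sem I (Us ! i)) \<Longrightarrow> msubst M xs Ns \<in> sem I U"
  shows "M : \<langle>fmap_of_list (zip xs Us) \<turnstile> U\<rangle>"
proof -
  obtain G :: "var \<Rightarrow> uty" where G: "surj G" using ex_surj_uty by blast
  define E where "E x = (case map_of (zip xs Us) x of Some V \<Rightarrow> V | None \<Rightarrow> {||})" for x
  \<comment> \<open>Variables with equal types under \<open>E\<close> share an image; this is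
    harmless, as \<open>has_ty_rename\<close> holds for every renaming.\<close>
  define f where "f x = inv G (E x)" for x
  let ?I = "\<lambda>a. {M. has_ty M G (Atom a)}"
  let ?Ns = "map (\<lambda>x. Var (f x)) xs"
  have Gf: "G (f x) = E x" for x
    using G by (simp add: f_def surj_f_inv_f)
  have E_nth: "E (xs ! i) = Us ! i" if "i < length xs" for i
    using that assms(2,3) by (simp add: E_def map_of_zip_nth)
  have "msubst M xs ?Ns = rename f M"
    using assms(4) by (auto simp: msubst_def rename_conv_subst map_of_zip_map intro!: subst_cong)
  moreover have "msubst M xs ?Ns \<in> sem ?I U"
  proof (rule assms(5))
    show "interpretation_of r ?I"
      using saturated_has_ty[OF assms(1)] by (auto simp: interpretation_of_def)
    show "\<forall>i<length xs. ?Ns ! i \<in> sem ?I (Us ! i)"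
      by (auto simp: sem_term_model[OF G] Gf E_nth intro: sub_fsubset)
  qed simp
  \<comment> \<open>Typing \<open>rename f M\<close> under \<open>G\<close> is typing
    \<open>M\<close> under \<open>G\<close> composed with \<open>f\<close>, which is
    \<open>E\<close>.\<close>
  ultimately have "has_ty M E T" if "T |\<in>| U" for T
    using that by (simp add: sem_term_model[OF G] has_ty_rename Gf)
  then have "M : \<langle>env_of E M \<turnstile> U\<rangle>" by (auto intro: typing_all[of U] has_ty_imp_typing)
  moreover have "env_of E M = fmap_of_list (zip xs Us)"
  proof (rule fmap_ext)
    fix x
    show "fmlookup (env_of E M) x = fmlookup (fmap_of_list (zip xs Us)) x"
    proof (cases "x \<in> set xs")
      case True
      then obtain V where "map_of (zip xs Us) x = Some V"
        using assms(3) by (metis map_of_zip_is_Some)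
      with True show ?thesis by (simp add: fmlookup_env_of fmlookup_of_list E_def assms(4))
    next
      case False
      then have "map_of (zip xs Us) x = None"
        using assms(3) by simp
      with False show ?thesis by (simp add: fmlookup_env_of fmlookup_of_list assms(4))
    qed
  qed
  ultimately show ?thesis by simp
qed

end
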